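(* Let $A,A^{*}$ be a Leonard pair that is totally bipartite or totally almost bipartite. Then there exist scalars $\beta,\varrho,\varrho^{*}\in\mathbb{K}$ with $\varrho,\varrho^{*}$ nonzero such that both $$A^{2}A^{*}-\beta AA^{*}A+A^{*}A^{2}=\varrho A^{*},\qquad A^{*2}A-\beta A^{*}AA^{*}+AA^{*2}=\varrho^{*}A.$$
   Context: $\mathbb{K}$ is an algebraically closed field of characteristic zero. A square matrix is tridiagonal if every nonzero entry lies on the diagonal, subdiagonal or superdiagonal; a tridiagonal matrix is irreducible if every subdiagonal and superdiagonal entry is nonzero. A tridiagonal matrix $B$ with rows and columns indexed by $0,\dots,d$ is bipartite if $B_{ii}=0$ for all $i$; it is almost bipartite if exactly one of $B_{00},B_{dd}$ is nonzero and $B_{ii}=0$ for $1\le i\le d-1$ (for $d=0$ this means $B_{00}\ne0$). Let $V$ be a $\mathbb{K}$-vector space of finite positive dimension $d+1$. A Leonard pair on $V$ is an ordered pair of linear maps $A,A^*:V\to V$ such that (1) there is a basis of $V$ in which $A$ is diagonal and $A^*$ is irreducible tridiagonal, and (2) there is a basis of $V$ in which $A^*$ is diagonal and $A$ is irreducible tridiagonal. It is totally bipartite (resp. totally almost bipartite) if the matrix of $A^*$ in (1) and the matrix of $A$ in (2) are both bipartite (resp. almost bipartite). *)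

theory Defs
  imports
    "HOL-Computational_Algebra.Polynomial"
    "Jordan_Normal_Form.Matrix"
begin

definition tridiagonal_mat :: "'k::zero mat \<Rightarrow> bool" where
  "tridiagonal_mat B \<longleftrightarrow> square_mat B \<and>
     (\<forall>i < dim_row B. \<forall>j < dim_row B. B $$ (i, j) \<noteq> 0 \<longrightarrow> i = j \<or> i = Suc j \<or> j = Suc i)"

definition irreducible_tridiagonal_mat :: "'k::zero mat \<Rightarrow> bool" where
  "irreducible_tridiagonal_mat B \<longleftrightarrow> tridiagonal_mat B \<and>
     (\<forall>i. Suc i < dim_row B \<longrightarrow> B $$ (Suc i, i) \<noteq> 0 \<and> B $$ (i, Suc i) \<noteq> 0)"

definition bipartite_mat :: "'k::zero mat \<Rightarrow> bool" where
  "bipartite_mat B \<longleftrightarrow> tridiagonal_mat B \<and> (\<forall>i < dim_row B. B $$ (i, i) = 0)"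

(* Rows and columns are indexed by 0..d with d = dim_row B - 1. *)
definition almost_bipartite_mat :: "'k::zero mat \<Rightarrow> bool" where
  "almost_bipartite_mat B \<longleftrightarrow> tridiagonal_mat B \<and> 0 < dim_row B \<and>
     (let d = dim_row B - 1 in
        (if d = 0 then B $$ (0, 0) \<noteq> 0
         else (B $$ (0, 0) \<noteq> 0) \<noteq> (B $$ (d, d) \<noteq> 0)) \<and>
        (\<forall>i. 1 \<le> i \<and> i < d \<longrightarrow> B $$ (i, i) = 0))"

definition ordered_basis :: "('k::field \<Rightarrow> 'v::ab_group_add \<Rightarrow> 'v) \<Rightarrow> 'v list \<Rightarrow> bool" where
  "ordered_basis scale bs \<longleftrightarrow> distinct bs \<and> \<not> module.dependent scale (set bs) \<and> module.span scale (set bs) = UNIV"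

(* Column convention: f (bs ! j) is the sum over i of (i, j)-entry times bs ! i. *)
definition matrix_wrt :: "('k::field \<Rightarrow> 'v::ab_group_add \<Rightarrow> 'v) \<Rightarrow> 'v list \<Rightarrow> ('v \<Rightarrow> 'v) \<Rightarrow> 'k mat" where
  "matrix_wrt scale bs f = mat (length bs) (length bs)
     (\<lambda>(i, j). module.representation scale (set bs) (f (bs ! j)) (bs ! i))"

definition leonard_pair :: "('k::field \<Rightarrow> 'v::ab_group_add \<Rightarrow> 'v) \<Rightarrow> ('v \<Rightarrow> 'v) \<Rightarrow> ('v \<Rightarrow> 'v) \<Rightarrow> bool" where
  "leonard_pair scale A A' \<longleftrightarrow>
     Vector_Spaces.linear scale scale A \<and> Vector_Spaces.linear scale scale A' \<and>
     (\<exists>bs. ordered_basis scale bs \<and> diagonal_mat (matrix_wrt scale bs A) \<and>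
        irreducible_tridiagonal_mat (matrix_wrt scale bs A')) \<and>
     (\<exists>bs. ordered_basis scale bs \<and> diagonal_mat (matrix_wrt scale bs A') \<and>
        irreducible_tridiagonal_mat (matrix_wrt scale bs A))"

(* A basis as in (1) or (2) of the definition of a Leonard pair is unique up to reversing
   the order and rescaling its members, so being (almost) bipartite does not depend on
   the basis chosen. *)
definition totally_bipartite :: "('k::field \<Rightarrow> 'v::ab_group_add \<Rightarrow> 'v) \<Rightarrow> ('v \<Rightarrow> 'v) \<Rightarrow> ('v \<Rightarrow> 'v) \<Rightarrow> bool" where
  "totally_bipartite scale A A' \<longleftrightarrow> leonard_pair scale A A' \<and>
     (\<exists>bs. ordered_basis scale bs \<and> diagonal_mat (matrix_wrt scale bs A) \<and>
        irreducible_tridiagonal_mat (matrix_wrt scale bs A') \<and> bipartite_mat (matrix_wrt scale bs A')) \<and>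
     (\<exists>bs. ordered_basis scale bs \<and> diagonal_mat (matrix_wrt scale bs A') \<and>
        irreducible_tridiagonal_mat (matrix_wrt scale bs A) \<and> bipartite_mat (matrix_wrt scale bs A))"

definition totally_almost_bipartite :: "('k::field \<Rightarrow> 'v::ab_group_add \<Rightarrow> 'v) \<Rightarrow> ('v \<Rightarrow> 'v) \<Rightarrow> ('v \<Rightarrow> 'v) \<Rightarrow> bool" where
  "totally_almost_bipartite scale A A' \<longleftrightarrow> leonard_pair scale A A' \<and>
     (\<exists>bs. ordered_basis scale bs \<and> diagonal_mat (matrix_wrt scale bs A) \<and>
        irreducible_tridiagonal_mat (matrix_wrt scale bs A') \<and> almost_bipartite_mat (matrix_wrt scale bs A')) \<and>
     (\<exists>bs. ordered_basis scale bs \<and> diagonal_mat (matrix_wrt scale bs A') \<and>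
        irreducible_tridiagonal_mat (matrix_wrt scale bs A) \<and> almost_bipartite_mat (matrix_wrt scale bs A))"

end

theory Submission
  imports Defs
begin

text \<open>
  With respect to a basis that diagonalises \<open>A\<close>, with eigenvalues \<open>\<theta>\<^sub>i\<close>, the first relation says that
  \<open>\<theta>\<^sub>i\<^sup>2 - \<beta> \<theta>\<^sub>i \<theta>\<^sub>j + \<theta>\<^sub>j\<^sup>2 = \<rho>\<close> whenever the \<open>(i, j)\<close> entry of \<open>A'\<close> is nonzero. To find \<open>\<beta>\<close> for
  \<open>d \<ge> 3\<close>, choose by interpolation a polynomial \<open>p\<close> of degree at most \<open>d\<close> with
  \<open>p(\<theta>\<^sub>i) - p(\<theta>\<^sub>j) = \<theta>\<^sub>i \<theta>\<^sub>j (\<theta>\<^sub>i - \<theta>\<^sub>j)\<close> for \<open>j = i + 1\<close>; then \<open>A\<^sup>2 A' A - A A' A\<^sup>2 = p(A) A' - A' p(A)\<close>. With respect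
  to the other basis the left side has bandwidth 3, which forces \<open>p\<close> to be cubic, and the
  entries at positions (0,3) and (1,3) show that its cubic coefficient is nonzero and its quadratic one zero,
  whence \<open>\<beta>\<close> and \<open>\<rho>\<close>. Comparing with the recurrence for
  the eigenvalues of \<open>A'\<close> obtained by duality shows that both relations share the same \<open>\<beta>\<close>. If \<open>\<rho>\<close> were zero,
  the last diagonal entry of the relation would force two eigenvalues of \<open>A'\<close> to coincide. The
  bandwidth argument is void for \<open>d \<le> 2\<close>, where suitable scalars are read off directly.\<close>

section \<open>Polynomial interpolation\<close>

text \<open>Newton's scheme: a multiple of \<open>q\<close>, which vanishes at the earlier nodes,
  corrects the value at the new one.\<close>

lemma poly_interpolation:
  fixes t x :: "nat \<Rightarrow> 'a::field"
  assumes "inj_on t {..d}"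
  shows "\<exists>p. degree p \<le> d \<and> (\<forall>i\<le>d. poly p (t i) = x i)"
  using assms
proof (induction d)
  case 0
  show ?case by (rule exI[of _ "[:x 0:]"]) simp
next
  case (Suc d)
  have "inj_on t {..d}" using Suc.prems by (rule inj_on_subset) auto
  with Suc.IH obtain p where p: "degree p \<le> d" "\<And>i. i \<le> d \<Longrightarrow> poly p (t i) = x i" by blast
  define q where "q = (\<Prod>j\<le>d. [:- t j, 1:])"
  have q0: "poly q (t i) = 0" if "i \<le> d" for i
    using that by (auto simp: q_def poly_prod)
  have q1: "poly q (t (Suc d)) \<noteq> 0"
    using Suc.prems by (force simp: q_def poly_prod inj_on_def)
  have dq: "degree q \<le> Suc d"
    using degree_prod_sum_le[of "{..d}" "\<lambda>j. [:- t j, 1:]"] by (simp add: q_def)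
  let ?p = "p + Polynomial.smult ((x (Suc d) - poly p (t (Suc d))) / poly q (t (Suc d))) q"
  have "degree ?p \<le> Suc d"
    using p(1) dq by (intro degree_add_le) (auto intro: order_trans[OF Polynomial.degree_smult_le])
  moreover have "poly ?p (t i) = x i" if "i \<le> Suc d" for i
    using that p(2) q0 q1 by (cases "i = Suc d") auto
  ultimately show ?case by blast
qed

section \<open>Coordinates for a tridiagonal map and a diagonal map\<close>

text \<open>\<open>f i\<close> is the \<open>i\<close>th coordinate functional of the basis \<open>v 0, \<dots>, v d\<close>, extended by zero to
  \<open>i > d\<close> so that the recurrences below hold for all indices; \<open>c\<close> is the only
  diagonal entry of \<open>A\<close> that may be nonzero. After reversing the basis if necessary, this covers
  both the bipartite and the almost bipartite case.\<close>

locale tridiagonal_coords = vector_space scale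
  for scale :: "'k::field \<Rightarrow> 'v::ab_group_add \<Rightarrow> 'v" +
  fixes d :: nat
    and f :: "nat \<Rightarrow> 'v \<Rightarrow> 'k"
    and v :: "nat \<Rightarrow> 'v"
    and A B :: "'v \<Rightarrow> 'v"
    and c :: 'k
    and l u t :: "nat \<Rightarrow> 'k"
  assumes f_add: "f i (x + y) = f i x + f i y"
    and f_scale: "f i (scale k x) = k * f i x"
    and f_v: "j \<le> d \<Longrightarrow> f i (v j) = (if i = j then 1 else 0)"
    and f_gt: "d < i \<Longrightarrow> f i x = 0"
    and f_separates: "(\<And>i. i \<le> d \<Longrightarrow> f i x = 0) \<Longrightarrow> x = 0"
    and f_B: "f i (B x) = t i * f i x"
    and f_A_0: "f 0 (A x) = c * f 0 x + u 0 * f (Suc 0) x"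
    and f_A_Suc: "f (Suc i) (A x) = l i * f i x + u (Suc i) * f (Suc (Suc i)) x"
    and l_nz: "i < d \<Longrightarrow> l i \<noteq> 0"
    and u_nz: "i < d \<Longrightarrow> u i \<noteq> 0"
    and l_z: "d \<le> i \<Longrightarrow> l i = 0"
    and u_z: "d \<le> i \<Longrightarrow> u i = 0"
begin

lemma f_0 [simp]: "f i 0 = 0"
  using f_scale[of i 0 0] by simp

lemma f_diff: "f i (x - y) = f i x - f i y"
  using f_add[of i "x - y" y] by simp

lemma f_sum: "f i (\<Sum>k\<in>S. g k) = (\<Sum>k\<in>S. f i (g k))"
  by (induction S rule: infinite_finite_induct) (simp_all add: f_add)

lemma f_inject: "(\<And>i. i \<le> d \<Longrightarrow> f i x = f i y) \<Longrightarrow> x = y"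
  using f_separates[of "x - y"] by (simp add: f_diff)

lemmas f_simps = f_add f_diff f_scale f_B f_A_0 f_A_Suc

lemma f_funpow_B: "f i ((B ^^ k) x) = t i ^ k * f i x"
  by (induction k) (simp_all add: f_B)

text \<open>Each application of \<open>A\<close> changes the index by at most one, so
  \<open>k\<close> of them cannot lead from \<open>j\<close> down to \<open>i\<close>.\<close>

lemma f_funpow_A_eq_0: "i + k < j \<Longrightarrow> j \<le> d \<Longrightarrow> f i ((A ^^ k) (v j)) = 0"
proof (induction k arbitrary: i)
  case (Suc k)
  then show ?case by (cases i) (simp_all add: f_simps)
qed (simp add: f_v)

text \<open>The only path of \<open>k\<close> steps from \<open>i + k\<close> to \<open>i\<close>
  descends throughout, so the coordinate is a product of nonzero entries \<open>u\<close>.\<close>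

lemma f_funpow_A_neq_0: "i + k \<le> d \<Longrightarrow> f i ((A ^^ k) (v (i + k))) \<noteq> 0"
proof (induction k arbitrary: i)
  case (Suc k)
  from Suc.IH[of "Suc i"] Suc.prems have *: "f (Suc i) ((A ^^ k) (v (Suc (i + k)))) \<noteq> 0"
    by simp
  have **: "f j ((A ^^ k) (v (Suc (i + k)))) = 0" if "j \<le> i" for j
    using f_funpow_A_eq_0[of j k "Suc (i + k)"] Suc.prems that by simp
  show ?case
    using * **[of i] **[of "i - 1"] u_nz[of i] Suc.prems by (cases i) (simp_all add: f_simps)
qed (simp add: f_v)

lemma f_funpow_A_scale: "f i ((A ^^ k) (scale r x)) = r * f i ((A ^^ k) x)"
proof (induction k arbitrary: i)
  case (Suc k)
  then show ?case by (cases i) (simp_all add: f_simps algebra_simps)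
qed (simp add: f_scale)

text \<open>As \<open>u j\<close> is nonzero, the eigenvector equation is a recurrence that
  determines coordinate \<open>Suc j\<close> from the earlier ones; \<open>f 0 x = 0\<close> would
  make all of them zero.\<close>

lemma eigenvector_coord_0:
  assumes eig: "A x = scale k x" and x: "x \<noteq> 0"
  shows "f 0 x \<noteq> 0"
proof
  assume 0: "f 0 x = 0"
  have "f i x = 0" if "i \<le> d" for i
    using that
  proof (induction i rule: less_induct)
    case (less i)
    show ?case
    proof (cases i)
      case (Suc j)
      have "f j (A x) = k * f j x" by (simp add: eig f_scale)
      then have "u j * f (Suc j) x = 0"
        using less Suc by (cases j) (simp_all add: f_simps)
      then show ?thesis using u_nz[of j] less.prems Suc by simp
    qed (simp add: 0)
  qed
  then show False using f_separates x by blast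
qed

lemma eigenvector_B: "i \<le> d \<Longrightarrow> B (v i) = scale (t i) (v i)"
  by (rule f_inject) (simp add: f_simps f_v)

lemma v_neq_0: "i \<le> d \<Longrightarrow> v i \<noteq> 0"
  using f_v[of i i] by auto

text \<open>In the basis \<open>v\<close> the relation is one condition for each nonzero entry of
  \<open>A\<close>. It is symmetric in the two indices, so \<open>off\<close> serves both the
  subdiagonal and the superdiagonal; \<open>corner\<close> belongs to the entry (0,0).\<close>

lemma cubic_relation_diag:
  assumes off: "\<And>i. i < d \<Longrightarrow> t i ^ 2 - \<beta> * t i * t (Suc i) + t (Suc i) ^ 2 = \<rho>"
    and corner: "c \<noteq> 0 \<Longrightarrow> (2 - \<beta>) * t 0 ^ 2 = \<rho>"
  shows "B (B (A x)) - scale \<beta> (B (A (B x))) + A (B (B x)) = scale \<rho> (A x)"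
proof (rule f_inject)
  fix i
  have U: "u i * (t i ^ 2 - \<beta> * t i * t (Suc i) + t (Suc i) ^ 2 - \<rho>) = 0" for i
    using off[of i] u_z[of i] by (cases "i < d") auto
  have L: "l i * (t i ^ 2 - \<beta> * t i * t (Suc i) + t (Suc i) ^ 2 - \<rho>) = 0" for i
    using off[of i] l_z[of i] by (cases "i < d") auto
  have C: "c * ((2 - \<beta>) * t 0 ^ 2 - \<rho>) = 0"
    using corner by auto
  show "f i (B (B (A x)) - scale \<beta> (B (A (B x))) + A (B (B x))) = f i (scale \<rho> (A x))"
  proof (cases i)
    case 0
    have "f 0 (B (B (A x)) - scale \<beta> (B (A (B x))) + A (B (B x))) - f 0 (scale \<rho> (A x))
       = c * ((2 - \<beta>) * t 0 ^ 2 - \<rho>) * f 0 x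
         + u 0 * (t 0 ^ 2 - \<beta> * t 0 * t (Suc 0) + t (Suc 0) ^ 2 - \<rho>) * f (Suc 0) x"
      by (simp add: f_simps algebra_simps power2_eq_square)
    then show ?thesis using 0 U C by simp
  next
    case (Suc j)
    have "f i (B (B (A x)) - scale \<beta> (B (A (B x))) + A (B (B x))) - f i (scale \<rho> (A x))
       = l j * (t j ^ 2 - \<beta> * t j * t (Suc j) + t (Suc j) ^ 2 - \<rho>) * f j x
         + u i * (t i ^ 2 - \<beta> * t i * t (Suc i) + t (Suc i) ^ 2 - \<rho>) * f (Suc i) x"
      by (simp add: Suc f_simps algebra_simps power2_eq_square)
    then show ?thesis using U L by simp
  qed
qed

text \<open>Compare the entries (i, i+2). Only the path through i+1 contributes, with
  \<open>B\<close> acting at its end, middle or start, and the diagonal right side has no such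
  entry.\<close>

lemma three_term:
  assumes rel: "\<And>x. A (A (B x)) - scale \<beta> (A (B (A x))) + B (A (A x)) = scale \<rho> (B x)"
    and i: "Suc (Suc i) \<le> d"
  shows "t i + t (Suc (Suc i)) = \<beta> * t (Suc i)"
proof -
  let ?v = "v (Suc (Suc i))"
  have "f i (A (A (B ?v)) - scale \<beta> (A (B (A ?v))) + B (A (A ?v))) = f i (scale \<rho> (B ?v))"
    by (simp only: rel)
  then have "u i * u (Suc i) * (t i + t (Suc (Suc i)) - \<beta> * t (Suc i)) = 0"
    using i by (cases i; cases "i - 1") (simp_all add: f_simps f_v algebra_simps)
  then show ?thesis using u_nz[of i] u_nz[of "Suc i"] i by simp
qed

text \<open>If \<open>\<rho> = 0\<close>, the entry (d, d) gives
  \<open>2 * t d = \<beta> * t (d - 1)\<close>, which the three-term recurrence turns into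
  \<open>t d = t (d - 2)\<close>.\<close>

lemma rho_nonzero:
  assumes rel: "\<And>x. A (A (B x)) - scale \<beta> (A (B (A x))) + B (A (A x)) = scale \<rho> (B x)"
    and d: "2 \<le> d" and inj: "inj_on t {..d}"
  shows "\<rho> \<noteq> 0"
proof
  assume "\<rho> = 0"
  obtain i where i: "d = Suc (Suc i)" using d by (metis Suc_le_D numeral_2_eq_2 Suc_le_mono)
  let ?v = "v (Suc (Suc i))"
  have "f d (A (A (B ?v)) - scale \<beta> (A (B (A ?v))) + B (A (A ?v))) = f d (scale \<rho> (B ?v))"
    by (simp only: rel)
  then have "l (Suc i) * u (Suc i) * (2 * t d - \<beta> * t (Suc i)) = 0"
    using \<open>\<rho> = 0\<close> u_z[of d] by (simp add: i f_simps f_v algebra_simps)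
  moreover have "\<beta> * t (Suc i) = t i + t d"
    using three_term[OF rel, of i] i by simp
  ultimately have "t d = t i"
    using u_nz[of "Suc i"] l_nz[of "Suc i"] i by simp
  then show False using inj_onD[OF inj, of d i] i by simp
qed

end

section \<open>Leonard pairs in coordinates\<close>

text \<open>In the basis \<open>v\<close> the map \<open>B\<close> is diagonal with eigenvalues
  \<open>t\<close>; in the basis \<open>w\<close> the map \<open>A\<close> is diagonal with
  eigenvalues \<open>t'\<close>. The setting is symmetric, so \<open>dual\<close> transfers each
  result to the exchanged pair.\<close>

locale leonard_coords =
  P: tridiagonal_coords scale d f v A B c l u t +
  Q: tridiagonal_coords scale d g w B A c' l' u' t'
  for scale :: "'k::field \<Rightarrow> 'v::ab_group_add \<Rightarrow> 'v"
    and d f v A B c l u t g w c' l' u' t'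
begin

lemma dual: "leonard_coords scale d g w B A c' l' u' t' f v c l u t"
  ..

text \<open>Eigenspaces of \<open>A\<close> are lines: two basis vectors \<open>w i\<close>,
  \<open>w j\<close> with a common eigenvalue would have a nontrivial combination whose coordinate
  \<open>f 0\<close> is zero.\<close>

lemma inj_t': "inj_on t' {..d}"
proof (rule inj_onI, rule ccontr)
  fix i j
  assume ij: "i \<in> {..d}" "j \<in> {..d}" and eq: "t' i = t' j" and ne: "i \<noteq> j"
  define x where "x = scale (f 0 (w j)) (w i) - scale (f 0 (w i)) (w j)"
  have "A x = scale (t' i) x"
    by (rule Q.f_inject) (use ij eq in \<open>auto simp: x_def Q.f_simps Q.f_v\<close>)
  moreover have "f 0 x = 0"
    by (simp add: x_def P.f_simps)
  ultimately have "x = 0"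
    using P.eigenvector_coord_0 by blast
  then have "g i x = 0" by simp
  then have "f 0 (w j) = 0"
    using ij ne by (simp add: x_def Q.f_simps Q.f_v)
  then show False
    using P.eigenvector_coord_0[OF Q.eigenvector_B[of j] Q.v_neq_0[of j]] ij by simp
qed

lemma inj_t: "inj_on t {..d}"
  by (rule leonard_coords.inj_t'[OF dual])

text \<open>The first conclusion is the off-diagonal condition for the relation in the basis
  \<open>w\<close>. The other two concern the eigenvalues of \<open>B\<close>: they serve to
  identify \<open>\<beta>\<close> with its dual and to obtain the condition at the corner entry
  \<open>c\<close>.\<close>

lemma cubic_relation_coefficients:
  assumes d: "3 \<le> d"
  obtains \<beta> \<rho> where
    "\<And>i. i < d \<Longrightarrow> t' i ^ 2 - \<beta> * t' i * t' (Suc i) + t' (Suc i) ^ 2 = \<rho>"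
    "t 3 - t 0 = (\<beta> + 1) * (t 2 - t 1)"
    "c \<noteq> 0 \<Longrightarrow> t 2 - t 0 = (\<beta> + 1) * (t 1 - t 0)"
proof -
  define xs where "xs i = (\<Sum>j<i. t' j * t' (Suc j) * (t' (Suc j) - t' j))" for i
  have xs_Suc: "xs (Suc i) = xs i + t' i * t' (Suc i) * (t' (Suc i) - t' i)" for i
    by (simp add: xs_def)
  obtain p where p: "degree p \<le> d" "\<And>i. i \<le> d \<Longrightarrow> poly p (t' i) = xs i"
    using poly_interpolation[OF inj_t', of xs] by blast
  \<comment> \<open>This is \<open>p(A)\<close>, hence diagonal in the basis \<open>w\<close> with
    eigenvalues \<open>xs i\<close>.\<close>
  define X where "X x = (\<Sum>k\<le>d. scale (coeff p k) ((A ^^ k) x))" for x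
  have poly_p: "poly p z = (\<Sum>k\<le>d. coeff p k * z ^ k)" for z
    unfolding poly_altdef by (rule sum.mono_neutral_left) (use p(1) in \<open>auto simp: coeff_eq_0\<close>)
  have gX: "g i (X x) = xs i * g i x" for i x
  proof (cases "i \<le> d")
    case True
    have "g i (X x) = poly p (t' i) * g i x"
      by (simp add: X_def Q.f_sum Q.f_scale Q.f_funpow_B poly_p sum_distrib_right mult.assoc)
    then show ?thesis using p(2) True by simp
  qed (simp add: Q.f_gt)
  \<comment> \<open>In the basis \<open>w\<close> both sides multiply the (i, j) entry of
    \<open>B\<close> by a factor that agrees for neighbours and is zero on the diagonal.\<close>
  have comm: "A (A (B (A x))) - A (B (A (A x))) = X (B x) - B (X x)" for x
  proof (rule Q.f_inject)
    show "g i (A (A (B (A x))) - A (B (A (A x)))) = g i (X (B x) - B (X x))" for i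
      by (cases i) (simp_all add: Q.f_simps gX xs_Suc algebra_simps)
  qed
  have fX: "f i (X x) = (\<Sum>k\<le>d. coeff p k * f i ((A ^^ k) x))" for i x
    by (simp add: X_def P.f_sum P.f_scale)
  have fXv: "f i (X (B (v j))) - f i (B (X (v j))) = (t j - t i) * f i (X (v j))" if "j \<le> d" for i j
  proof -
    have "f i (X (B (v j))) = t j * f i (X (v j))"
      using that by (simp add: fX P.eigenvector_B P.f_funpow_A_scale sum_distrib_left mult.left_commute)
    then show ?thesis by (simp add: P.f_B left_diff_distrib)
  qed
  have entry: "f i (A (A (B (A (v j))))) - f i (A (B (A (A (v j))))) = (t j - t i) * f i (X (v j))"
    if "j \<le> d" for i j
    using arg_cong[OF comm[of "v j"], of "f i"] fXv[OF that, of i] by (simp only: P.f_diff)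
  have deg: "degree p \<le> 3"
  proof (rule ccontr)
    \<comment> \<open>At position (0, n) only the leading term of \<open>p\<close> contributes,
      while a product with three factors \<open>A\<close> has no entry so far from the
      diagonal.\<close>
    assume "\<not> degree p \<le> 3"
    define n where "n = degree p"
    have n: "3 < n" "n \<le> d" using \<open>\<not> degree p \<le> 3\<close> p(1) by (simp_all add: n_def)
    have "f 0 (X (v n)) = (\<Sum>k\<in>{n}. coeff p k * f 0 ((A ^^ k) (v n)))"
      unfolding fX
    proof (rule sum.mono_neutral_right)
      show "\<forall>k\<in>{..d} - {n}. coeff p k * f 0 ((A ^^ k) (v n)) = 0"
      proof
        fix k assume "k \<in> {..d} - {n}"
        then consider "k < n" | "n < k" by fastforce
        then show "coeff p k * f 0 ((A ^^ k) (v n)) = 0"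
          by cases (use n P.f_funpow_A_eq_0[of 0 k n] in \<open>auto simp: n_def coeff_eq_0\<close>)
      qed
    qed (use n in auto)
    moreover have "coeff p n \<noteq> 0" using n by (auto simp: n_def)
    ultimately have "f 0 (X (v n)) \<noteq> 0"
      using P.f_funpow_A_neq_0[of 0 n] n by simp
    moreover have "t n \<noteq> t 0"
      using inj_onD[OF inj_t, of n 0] n by auto
    moreover have "f 0 (A (A (B (A (v n))))) - f 0 (A (B (A (A (v n))))) = 0"
      using n by (simp add: P.f_simps P.f_v numeral_3_eq_3)
    ultimately show False using entry[of n 0] n by simp
  qed
  define c1 c2 c3 where "c1 = coeff p 1" and "c2 = coeff p 2" and "c3 = coeff p 3"
  have fX3: "f i (X x) = coeff p 0 * f i x + c1 * f i (A x) + c2 * f i (A (A x)) + c3 * f i (A (A (A x)))"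
    for i x
  proof -
    have "f i (X x) = (\<Sum>k\<le>3. coeff p k * f i ((A ^^ k) x))"
      unfolding fX by (rule sum.mono_neutral_right) (use d deg in \<open>auto simp: coeff_eq_0\<close>)
    then show ?thesis
      by (simp add: c1_def c2_def c3_def eval_nat_numeral add.assoc)
  qed
  note entry' = entry[unfolded fX3]
  have d': "Suc 0 \<le> d" "Suc (Suc 0) \<le> d" "Suc (Suc (Suc 0)) \<le> d" using d by auto
  have u: "u 0 \<noteq> 0" "u (Suc 0) \<noteq> 0" "u (Suc (Suc 0)) \<noteq> 0" using d P.u_nz by auto
  have "u 0 * u (Suc 0) * u (Suc (Suc 0)) * (t 2 - t 1) = u 0 * u (Suc 0) * u (Suc (Suc 0)) * (c3 * (t 3 - t 0))"
    using entry'[of 3 0] d d' by (simp add: P.f_simps P.f_v eval_nat_numeral algebra_simps)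
  then have e03: "t 2 - t 1 = c3 * (t 3 - t 0)" using u by simp
  \<comment> \<open>A path of three steps from 3 to 1 would need a nonzero diagonal entry at an
    index from 1 to 3, so only the quadratic term survives.\<close>
  have "u (Suc 0) * u (Suc (Suc 0)) * (c2 * (t 1 - t 3)) = 0"
    using entry'[of 3 1] d d' by (simp add: P.f_simps P.f_v eval_nat_numeral algebra_simps)
  moreover have "t 1 \<noteq> t 3" using inj_onD[OF inj_t, of 1 3] d by auto
  ultimately have c2: "c2 = 0" using u by simp
  \<comment> \<open>At position (0, 2) the only path of three steps uses the loop at 0, of weight
    \<open>c\<close>.\<close>
  have "c * u 0 * u (Suc 0) * (t 1 - t 0) = c * u 0 * u (Suc 0) * (c3 * (t 2 - t 0))"
    using entry'[of 2 0] d d' by (simp add: c2 P.f_simps P.f_v eval_nat_numeral algebra_simps)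
  then have e02: "c \<noteq> 0 \<Longrightarrow> t 1 - t 0 = c3 * (t 2 - t 0)" using u by simp
  have "t 2 \<noteq> t 1" using inj_onD[OF inj_t, of 2 1] d by auto
  then have c3: "c3 \<noteq> 0" using e03 by auto
  have poly3: "poly p z = coeff p 0 + c1 * z + c3 * z ^ 3" for z
  proof -
    have "poly p z = (\<Sum>k\<le>3. coeff p k * z ^ k)"
      unfolding poly_altdef by (rule sum.mono_neutral_left) (use deg in \<open>auto simp: coeff_eq_0\<close>)
    then show ?thesis
      using c2 by (simp add: c1_def c2_def c3_def eval_nat_numeral)
  qed
  show thesis
  \<comment> \<open>The witnesses are \<open>\<beta> = 1 / c3 - 1\<close> and
    \<open>\<rho> = - c1 / c3\<close>. They come from dividing the difference of \<open>p\<close> at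
    consecutive eigenvalues by \<open>t' (Suc i) - t' i\<close>.\<close>
  proof (rule that)
    fix i assume i: "i < d"
    have ne: "t' (Suc i) - t' i \<noteq> 0"
      using inj_onD[OF inj_t', of "Suc i" i] i by auto
    have "xs (Suc i) - xs i = poly p (t' (Suc i)) - poly p (t' i)"
      using p(2) i by simp
    also have "\<dots> = c1 * (t' (Suc i) - t' i) + c3 * (t' (Suc i) ^ 3 - t' i ^ 3)"
      by (simp add: poly3 algebra_simps)
    finally have "xs (Suc i) - xs i = c1 * (t' (Suc i) - t' i) + c3 * (t' (Suc i) ^ 3 - t' i ^ 3)" .
    then have "(t' (Suc i) - t' i) * (t' i * t' (Suc i)) =
      (t' (Suc i) - t' i) * (c1 + c3 * (t' i ^ 2 + t' i * t' (Suc i) + t' (Suc i) ^ 2))"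
      by (simp add: xs_Suc algebra_simps power2_eq_square power3_eq_cube)
    then have eq: "t' i * t' (Suc i) = c1 + c3 * (t' i ^ 2 + t' i * t' (Suc i) + t' (Suc i) ^ 2)"
      using ne by simp
    have "c3 * (t' i ^ 2 - (1 / c3 - 1) * t' i * t' (Suc i) + t' (Suc i) ^ 2) =
      (c1 + c3 * (t' i ^ 2 + t' i * t' (Suc i) + t' (Suc i) ^ 2)) - t' i * t' (Suc i) - c1"
      using c3 by (simp add: field_simps)
    also have "\<dots> = - c1"
      unfolding eq[symmetric] by simp
    finally show "t' i ^ 2 - (1 / c3 - 1) * t' i * t' (Suc i) + t' (Suc i) ^ 2 = - c1 / c3"
      using c3 by (metis nonzero_mult_div_cancel_left)
  qed (use e03 e02 c3 in \<open>auto simp: field_simps\<close>)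
qed

definition cubic_relations :: bool where
  "cubic_relations \<longleftrightarrow> (\<exists>\<beta> \<rho> \<rho>'. \<rho> \<noteq> 0 \<and> \<rho>' \<noteq> 0 \<and>
    (\<forall>x. A (A (B x)) - scale \<beta> (A (B (A x))) + B (A (A x)) = scale \<rho> (B x)) \<and>
    (\<forall>x. B (B (A x)) - scale \<beta> (B (A (B x))) + A (B (B x)) = scale \<rho>' (A x)))"

end

lemma le_2_cases: "i \<le> 2 \<Longrightarrow> i = 0 \<or> i = Suc 0 \<or> i = Suc (Suc 0)" for i :: nat
  by auto

section \<open>A common \<open>\<beta>\<close> for \<open>d \<ge> 3\<close>\<close>

lemma three_term_of_invariant:
  fixes x y z \<beta> \<rho> :: "'a::field"
  assumes "x ^ 2 - \<beta> * x * y + y ^ 2 = \<rho>" and "y ^ 2 - \<beta> * y * z + z ^ 2 = \<rho>" and "x \<noteq> z"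
  shows "x + z = \<beta> * y"
proof -
  have "(x - z) * (x + z - \<beta> * y) = (x ^ 2 - \<beta> * x * y + y ^ 2) - (y ^ 2 - \<beta> * y * z + z ^ 2)"
    by (simp add: algebra_simps power2_eq_square)
  then have "(x - z) * (x + z - \<beta> * y) = 0"
    by (simp only: assms(1,2) diff_self)
  then show ?thesis using assms(3) by simp
qed

text \<open>The two linear assumptions give \<open>y = (\<beta> - 1) * x\<close>, which turns the
  quadratic form into a multiple of \<open>x ^ 2\<close>. This supplies the corner
  condition.\<close>

lemma end_invariant:
  fixes x y z \<beta> \<rho> :: "'a::field"
  assumes "x + z = \<beta> * y" and "z - x = (\<beta> + 1) * (y - x)" and "x ^ 2 - \<beta> * x * y + y ^ 2 = \<rho>"
  shows "(2 - \<beta>) * x ^ 2 = \<rho>"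
proof -
  have z: "z = \<beta> * y - x" using assms(1) by (simp add: algebra_simps)
  have y: "y = (\<beta> - 1) * x" using assms(2) by (simp add: z algebra_simps)
  then show ?thesis
    unfolding assms(3)[symmetric] y by (simp add: algebra_simps power2_eq_square)
qed

lemma (in leonard_coords) cubic_relations_ge_3:
  assumes d: "3 \<le> d"
  shows cubic_relations
proof -
  obtain \<beta> \<rho> where P: "\<And>i. i < d \<Longrightarrow> t' i ^ 2 - \<beta> * t' i * t' (Suc i) + t' (Suc i) ^ 2 = \<rho>"
      "t 3 - t 0 = (\<beta> + 1) * (t 2 - t 1)" "c \<noteq> 0 \<Longrightarrow> t 2 - t 0 = (\<beta> + 1) * (t 1 - t 0)"
    using cubic_relation_coefficients[OF d] by blast
  obtain \<beta>' \<rho>' where Q: "\<And>i. i < d \<Longrightarrow> t i ^ 2 - \<beta>' * t i * t (Suc i) + t (Suc i) ^ 2 = \<rho>'"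
      "t' 3 - t' 0 = (\<beta>' + 1) * (t' 2 - t' 1)" "c' \<noteq> 0 \<Longrightarrow> t' 2 - t' 0 = (\<beta>' + 1) * (t' 1 - t' 0)"
    using leonard_coords.cubic_relation_coefficients[OF dual d] by blast
  have ne: "t 1 \<noteq> t 2" "t 0 \<noteq> t 2" "t 1 \<noteq> t 3" "t' 0 \<noteq> t' 2"
    using d inj_onD[OF inj_t, of 1 2] inj_onD[OF inj_t, of 0 2] inj_onD[OF inj_t, of 1 3]
      inj_onD[OF inj_t', of 0 2] by auto
  have three: "t 0 + t 2 = \<beta>' * t 1" "t 1 + t 3 = \<beta>' * t 2" "t' 0 + t' 2 = \<beta> * t' 1"
    using Q(1)[of 0] Q(1)[of 1] Q(1)[of 2] P(1)[of 0] P(1)[of 1] d ne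
    by (auto intro!: three_term_of_invariant simp: eval_nat_numeral)
  have t: "t 0 = \<beta>' * t 1 - t 2" "t 3 = \<beta>' * t 2 - t 1"
    using three(1,2) by (simp_all add: algebra_simps)
  \<comment> \<open>Both sides are \<open>t 3 - t 0\<close>: the left by the recurrence for
    \<open>\<beta>'\<close>, the right by the analysis of \<open>p\<close>.\<close>
  have "(\<beta>' + 1) * (t 2 - t 1) = (\<beta> + 1) * (t 2 - t 1)"
    unfolding P(2)[symmetric] t by (simp add: algebra_simps)
  then have \<beta>: "\<beta>' = \<beta>" using ne by simp
  have "0 < d" using d by simp
  note corner' = end_invariant[OF three(3) Q(3)[unfolded \<beta>] P(1)[OF \<open>0 < d\<close>, folded One_nat_def]]
  note corner = end_invariant[OF three(1)[unfolded \<beta>] P(3) Q(1)[OF \<open>0 < d\<close>, folded One_nat_def, unfolded \<beta>]]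
  note rel = Q.cubic_relation_diag[OF P(1) corner'] and rel' = P.cubic_relation_diag[OF Q(1)[unfolded \<beta>] corner]
  show ?thesis
    unfolding cubic_relations_def
    \<comment> \<open>Each relation was verified in one basis; that its scalar is nonzero is read
      off in the other.\<close>
    using P.rho_nonzero[OF rel _ inj_t] Q.rho_nonzero[OF rel' _ inj_t'] rel rel' d by force
qed

section \<open>The cases \<open>d \<le> 2\<close>\<close>

context leonard_coords
begin

lemma cubic_relationsI:
  assumes "\<And>i. i < d \<Longrightarrow> t' i ^ 2 - \<beta> * t' i * t' (Suc i) + t' (Suc i) ^ 2 = \<rho>"
    and "c' \<noteq> 0 \<Longrightarrow> (2 - \<beta>) * t' 0 ^ 2 = \<rho>"
    and "\<And>i. i < d \<Longrightarrow> t i ^ 2 - \<beta> * t i * t (Suc i) + t (Suc i) ^ 2 = \<rho>'"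
    and "c \<noteq> 0 \<Longrightarrow> (2 - \<beta>) * t 0 ^ 2 = \<rho>'"
    and "\<rho> \<noteq> 0" "\<rho>' \<noteq> 0"
  shows cubic_relations
  unfolding cubic_relations_def
  using P.cubic_relation_diag[OF assms(3,4)] Q.cubic_relation_diag[OF assms(1,2)] assms(5,6)
  by blast

lemma t'_0_neq_0_if_0:
  assumes d: "d = 0" and c: "c \<noteq> 0"
  shows "t' 0 \<noteq> 0"
proof
  assume t: "t' 0 = 0"
  have "f 0 (A (w 0)) = f 0 (scale (t' 0) (w 0))" by (simp only: Q.eigenvector_B)
  then have "f 0 (w 0) = 0" using c P.u_z d t by (simp add: P.f_simps)
  then show False
    using P.eigenvector_coord_0[OF Q.eigenvector_B[of 0] Q.v_neq_0[of 0]] by simp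
qed

lemma cubic_relations_0:
  assumes d: "d = 0" and c: "c = 0 \<longleftrightarrow> c' = 0"
  shows cubic_relations
proof (cases "c = 0")
  case True
  show ?thesis
    \<comment> \<open>Both maps are zero here, so any scalars will do.\<close>
    by (rule cubic_relationsI[of 0 1 1]) (use True c d in auto)
next
  case False
  show ?thesis
    by (rule cubic_relationsI[of 1 "t' 0 ^ 2" "t 0 ^ 2"])
      (use False c d t'_0_neq_0_if_0 leonard_coords.t'_0_neq_0_if_0[OF dual] in auto)
qed

text \<open>Identity \<open>1\<close> is Cayley-Hamilton for \<open>A\<close> and identity
  \<open>2\<close> its polarisation with \<open>B\<close>. Both are checked in the basis
  \<open>w\<close> and then read in the basis \<open>v\<close>.\<close>

lemma entries_1:
  assumes d: "d = 1"
  shows "c = t' 0 + t' 1" and "t' 0 * t' 1 \<noteq> 0" and "(t' 0 + t' 1) * t 1 = t' 1 * c'"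
proof -
  have u: "u 0 \<noteq> 0" "u (Suc 0) = 0" "l 0 \<noteq> 0" "l' (Suc 0) = 0" "u' (Suc 0) = 0"
    using P.u_nz P.u_z P.l_nz Q.l_z Q.u_z d by auto
  have 1: "A (A x) = scale (t' 0 + t' 1) (A x) - scale (t' 0 * t' 1) x" for x
  proof (rule Q.f_inject)
    show "g i (A (A x)) = g i (scale (t' 0 + t' 1) (A x) - scale (t' 0 * t' 1) x)"
      if "i \<le> d" for i
      using that by (auto simp: le_Suc_eq Q.f_simps d u algebra_simps)
  qed
  have 2: "A (B x) + B (A x) = scale (t' 0 + t' 1) (B x) + scale c' (A x) - scale (t' 1 * c') x" for x
  proof (rule Q.f_inject)
    show "g i (A (B x) + B (A x)) = g i (scale (t' 0 + t' 1) (B x) + scale c' (A x) - scale (t' 1 * c') x)"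
      if "i \<le> d" for i
      using that by (auto simp: le_Suc_eq Q.f_simps d u algebra_simps)
  qed
  have "c * u 0 = (t' 0 + t' 1) * u 0"
    using arg_cong[OF 1[of "v 1"], of "f 0"] d by (simp add: P.f_simps P.f_v u)
  then show "c = t' 0 + t' 1" using u by simp
  have "l 0 * u 0 = - (t' 0 * t' 1)"
    using arg_cong[OF 1[of "v 1"], of "f 1"] d by (simp add: P.f_simps P.f_v u)
  then show "t' 0 * t' 1 \<noteq> 0" using u by auto
  show "(t' 0 + t' 1) * t 1 = t' 1 * c'"
    using arg_cong[OF 2[of "v 1"], of "f 1"] d by (simp add: P.f_simps P.f_v u)
qed

lemma cubic_relations_1:
  assumes d: "d = 1"
  shows cubic_relations
proof -
  note P = entries_1[OF d] and Q = leonard_coords.entries_1[OF dual d]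
  have nz: "t' 0 \<noteq> 0" "t 0 \<noteq> 0" using P(2) Q(2) by auto
  have "t' 0 * t 1 = t' 1 * t 0" using P(3) Q(1) by (simp add: algebra_simps)
  then have ratio: "t' 1 / t' 0 = t 1 / t 0" using nz by (simp add: field_simps)
  have ne: "t' 0 \<noteq> t' 1" "t 0 \<noteq> t 1"
    using inj_onD[OF inj_t', of 0 1] inj_onD[OF inj_t, of 0 1] d by auto
  show ?thesis
  \<comment> \<open>Equating the corner condition with the off-diagonal one forces
    \<open>\<beta> = 1 + r\<close>, where \<open>r\<close> is the ratio of the two eigenvalues; by
    \<open>ratio\<close> it is the same for \<open>A\<close> and \<open>B\<close>.\<close>
  proof (rule cubic_relationsI[of "1 + t' 1 / t' 0" "t' 0 * (t' 0 - t' 1)" "t 0 * (t 0 - t 1)"])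
    show "t' i ^ 2 - (1 + t' 1 / t' 0) * t' i * t' (Suc i) + t' (Suc i) ^ 2 = t' 0 * (t' 0 - t' 1)"
      if "i < d" for i
      using that d nz by (simp add: field_simps power2_eq_square)
    show "t i ^ 2 - (1 + t' 1 / t' 0) * t i * t (Suc i) + t (Suc i) ^ 2 = t 0 * (t 0 - t 1)"
      if "i < d" for i
      unfolding ratio using that d nz by (simp add: field_simps power2_eq_square)
    show "(2 - (1 + t' 1 / t' 0)) * t' 0 ^ 2 = t' 0 * (t' 0 - t' 1)"
      using nz by (simp add: field_simps power2_eq_square)
    show "(2 - (1 + t' 1 / t' 0)) * t 0 ^ 2 = t 0 * (t 0 - t 1)"
      unfolding ratio using nz by (simp add: field_simps power2_eq_square)
  qed (use nz ne in auto)
qed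

text \<open>With \<open>c = 0\<close>, a product with three factors \<open>A\<close> has no entry at
  (0, 2) by parity. Identity \<open>1\<close> holds since one of two neighbouring indices is 1;
  identity \<open>2\<close> expresses that \<open>A\<close> is annihilated by the product over its
  eigenvalues.\<close>

lemma eigenvalues_2_bipartite:
  assumes d: "d = 2" and c: "c = 0"
  shows "t' 1 = 0" and "t' 0 + t' 2 = 0"
proof -
  have u: "u 0 \<noteq> 0" "u (Suc 0) \<noteq> 0" "u (Suc (Suc 0)) = 0" "l' (Suc (Suc 0)) = 0" "u' (Suc (Suc 0)) = 0"
    using P.u_nz P.u_z Q.l_z Q.u_z d by auto
  have 1: "A (A (B (A x))) - A (B (A (A x))) =
    scale (t' 1) (A (A (B x)) - B (A (A x))) - scale (t' 1 ^ 2) (A (B x) - B (A x))" for x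
  proof (rule Q.f_inject)
    show "g i (A (A (B (A x))) - A (B (A (A x)))) =
      g i (scale (t' 1) (A (A (B x)) - B (A (A x))) - scale (t' 1 ^ 2) (A (B x) - B (A x)))"
      if "i \<le> d" for i
      using le_2_cases[of i] that d
      by (auto simp: Q.f_simps d u power2_eq_square algebra_simps)
  qed
  have "u 0 * u (Suc 0) * (t' 1 * (t 0 - t 2)) = 0"
    using arg_cong[OF 1[of "v (Suc (Suc 0))"], of "f 0"] d
    by (simp add: P.f_simps P.f_v u c numeral_2_eq_2 algebra_simps)
  moreover have "t 0 \<noteq> t 2" using inj_onD[OF inj_t, of 0 2] d by auto
  ultimately show 0: "t' 1 = 0" using u by simp
  have 2: "A (A (A x)) = scale (t' 0 + t' 2) (A (A x)) - scale (t' 0 * t' 2) (A x)" for x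
  proof (rule Q.f_inject)
    show "g i (A (A (A x))) = g i (scale (t' 0 + t' 2) (A (A x)) - scale (t' 0 * t' 2) (A x))"
      if "i \<le> d" for i
      using le_2_cases[of i] that d 0
      by (auto simp: Q.f_simps d algebra_simps numeral_2_eq_2)
  qed
  have "(t' 0 + t' 2) * (u 0 * u (Suc 0)) = 0"
    using arg_cong[OF 2[of "v (Suc (Suc 0))"], of "f 0"] d
    by (simp add: P.f_simps P.f_v u c numeral_2_eq_2)
  then show "t' 0 + t' 2 = 0" using u by simp
qed

lemma cubic_relations_2_bipartite:
  assumes d: "d = 2" and c: "c = 0" "c' = 0"
  shows cubic_relations
proof -
  note P = eigenvalues_2_bipartite[OF d c(1)] and Q = leonard_coords.eigenvalues_2_bipartite[OF dual d c(2)]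
  have ne: "t' 0 \<noteq> t' 1" "t 0 \<noteq> t 1"
    using inj_onD[OF inj_t', of 0 1] inj_onD[OF inj_t, of 0 1] d by auto
  have sq: "t' 2 ^ 2 = t' 0 ^ 2" "t 2 ^ 2 = t 0 ^ 2"
    using P(2) Q(2) by (simp_all add: eq_neg_iff_add_eq_0[symmetric] add.commute)
  show ?thesis
    by (rule cubic_relationsI[of 0 "t' 0 ^ 2" "t 0 ^ 2"])
      (use P(1) Q(1) ne sq c d in \<open>auto simp: less_Suc_eq numeral_2_eq_2\<close>)
qed

text \<open>\<open>A\<close> is injective: for a kernel vector the last row gives coordinate 1 equal
  to zero, and then row 0 with \<open>c \<noteq> 0\<close> gives coordinate 0 equal to zero.\<close>

lemma t'_neq_0_2:
  assumes d: "d = 2" and c: "c \<noteq> 0" and i: "i \<le> 2"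
  shows "t' i \<noteq> 0"
proof
  assume t: "t' i = 0"
  have u: "u 0 \<noteq> 0" "u (Suc 0) \<noteq> 0" "u (Suc (Suc 0)) = 0" "l (Suc 0) \<noteq> 0"
    using P.u_nz P.u_z P.l_nz d by auto
  have A: "f j (A (w i)) = 0" for j
    using Q.eigenvector_B[of i] d i t by (simp add: P.f_simps)
  have "f (Suc 0) (w i) = 0"
    using A[of "Suc (Suc 0)"] u by (simp add: P.f_simps)
  moreover from this have "f 0 (w i) = 0"
    using A[of 0] c by (simp add: P.f_simps)
  ultimately show False
    using P.eigenvector_coord_0[OF Q.eigenvector_B[of i] Q.v_neq_0[of i]] d i by simp
qed

text \<open>With \<open>\<beta>\<close> chosen such that the off-diagonal entries vanish with respect to \<open>w\<close>, the defect \<open>G\<close> of the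
  cubic relation is \<open>\<kappa>\<close> times the projection onto \<open>w 0\<close>. Its \<open>(1, 2)\<close> entry with respect
  to \<open>v\<close> is zero, while that of the projection is not.\<close>

lemma relation_2_almost_bipartite:
  assumes d: "d = 2" and c: "c \<noteq> 0"
  obtains \<beta> \<rho> where "t' 0 + t' 2 = \<beta> * t' 1" "t 0 + t 2 = \<beta> * t 1"
    "\<And>x. A (A (B x)) - scale \<beta> (A (B (A x))) + B (A (A x)) = scale \<rho> (B x)"
proof -
  have u: "u 0 \<noteq> 0" "u (Suc 0) \<noteq> 0" "u (Suc (Suc 0)) = 0" "l 0 \<noteq> 0" "l (Suc 0) \<noteq> 0"
      "l' (Suc (Suc 0)) = 0" "u' (Suc (Suc 0)) = 0"
    using P.u_nz P.u_z P.l_nz Q.l_z Q.u_z d by auto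
  have nz: "t' 0 \<noteq> 0" "t' 1 \<noteq> 0" using t'_neq_0_2[OF d c] by auto
  define \<beta> where "\<beta> = (t' 0 + t' 2) / t' 1"
  define \<rho> where "\<rho> = t' 0 ^ 2 - \<beta> * t' 0 * t' 1 + t' 1 ^ 2"
  define \<kappa> where "\<kappa> = c' * ((2 - \<beta>) * t' 0 ^ 2 - \<rho>)"
  define G where "G x = A (A (B x)) - scale \<beta> (A (B (A x))) + B (A (A x)) - scale \<rho> (B x)" for x
  have t'2: "t' (Suc (Suc 0)) = \<beta> * t' (Suc 0) - t' 0"
    using nz by (simp add: \<beta>_def numeral_2_eq_2)
  have G: "G x = scale (\<kappa> * g 0 x) (w 0)" for x
  proof (rule Q.f_inject)
    show "g i (G x) = g i (scale (\<kappa> * g 0 x) (w 0))"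
      if "i \<le> d" for i
      using le_2_cases[of i] that d
      by (auto simp: G_def \<kappa>_def \<rho>_def t'2 Q.f_simps Q.f_v d u power2_eq_square algebra_simps)
  qed
  have f1: "f (Suc 0) (w 0) \<noteq> 0"
  proof
    assume 0: "f (Suc 0) (w 0) = 0"
    have A: "f j (A (w 0)) = t' 0 * f j (w 0)" for j
      by (simp add: Q.eigenvector_B P.f_scale)
    have "f (Suc (Suc 0)) (w 0) = 0"
      using A[of "Suc (Suc 0)"] 0 u nz by (simp add: P.f_simps)
    then have "f 0 (w 0) = 0"
      using A[of "Suc 0"] 0 u by (simp add: P.f_simps)
    then show False
      using P.eigenvector_coord_0[OF Q.eigenvector_B[of 0] Q.v_neq_0[of 0]] by simp
  qed
  have g0: "g 0 (v (Suc (Suc 0))) \<noteq> 0"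
    using Q.eigenvector_coord_0[OF P.eigenvector_B P.v_neq_0] d by simp
  \<comment> \<open>A path of two steps between 2 and 1 would need a nonzero diagonal entry of
    \<open>A\<close> at 1 or 2.\<close>
  have "f (Suc 0) (G (v (Suc (Suc 0)))) = 0"
    using d by (simp add: G_def P.f_simps P.f_v)
  then have "\<kappa> = 0"
    using f1 g0 by (simp add: G P.f_scale)
  then have rel: "A (A (B x)) - scale \<beta> (A (B (A x))) + B (A (A x)) = scale \<rho> (B x)" for x
    using G[of x] by (simp add: G_def)
  have "t' 0 + t' 2 = \<beta> * t' 1" using nz by (simp add: \<beta>_def)
  moreover have "t 0 + t 2 = \<beta> * t 1"
    using P.three_term[OF rel, of 0] d by (simp add: numeral_2_eq_2)
  ultimately show thesis using rel by (rule that)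
qed

lemma cubic_relations_2_almost_bipartite:
  assumes d: "d = 2" and c: "c \<noteq> 0" "c' \<noteq> 0"
  shows cubic_relations
proof -
  obtain \<beta> \<rho> where P: "t' 0 + t' 2 = \<beta> * t' 1"
      "\<And>x. A (A (B x)) - scale \<beta> (A (B (A x))) + B (A (A x)) = scale \<rho> (B x)"
    using relation_2_almost_bipartite[OF d c(1)] by metis
  obtain \<beta>' \<rho>' where Q: "t' 0 + t' 2 = \<beta>' * t' 1"
      "\<And>x. B (B (A x)) - scale \<beta>' (B (A (B x))) + A (B (B x)) = scale \<rho>' (A x)"
    using leonard_coords.relation_2_almost_bipartite[OF dual d c(2)] by metis
  \<comment> \<open>The dual instance also yields the recurrence for \<open>t'\<close>, and
    \<open>t' 1\<close> is nonzero.\<close>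
  have "\<beta>' = \<beta>" using P(1) Q(1) t'_neq_0_2[OF d c(1), of 1] by simp
  then show ?thesis
    unfolding cubic_relations_def
    using P.rho_nonzero[OF P(2) _ inj_t] Q.rho_nonzero[OF Q(2) _ inj_t'] P(2) Q(2) d by force
qed

lemma cubic_relations:
  assumes "c = 0 \<longleftrightarrow> c' = 0"
  shows cubic_relations
proof -
  consider "d = 0" | "d = 1" | "d = 2" | "3 \<le> d" by linarith
  then show ?thesis
    using assms cubic_relations_0 cubic_relations_1 cubic_relations_2_bipartite
      cubic_relations_2_almost_bipartite cubic_relations_ge_3 by cases auto
qed

end

section \<open>From matrices to coordinates\<close>

lemma set_eq_nth_image: "set bs = (!) bs ` {..d}" if "length bs = Suc d"
  using that by (auto simp: set_conv_nth less_Suc_eq_le)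

context vector_space
begin

lemma representation_apply:
  assumes bs: "ordered_basis scale bs" and len: "length bs = Suc d"
    and F: "Vector_Spaces.linear scale scale F" and i: "i \<le> d"
  shows "representation (set bs) (F x) (bs ! i) =
    (\<Sum>j\<le>d. matrix_wrt scale bs F $$ (i, j) * representation (set bs) x (bs ! j))"
proof -
  interpret F: Vector_Spaces.linear scale scale F by (rule F)
  have ind: "independent (set bs)" and span: "span (set bs) = UNIV" and dist: "distinct bs"
    using bs by (simp_all add: ordered_basis_def)
  have inj: "inj_on ((!) bs) {..d}"
    using dist len by (auto simp: inj_on_def nth_eq_iff_index_eq)
  have "x = (\<Sum>b\<in>set bs. scale (representation (set bs) x b) b)"
    by (rule sum_representation_eq[symmetric]) (use ind span in auto)
  then have "x = (\<Sum>j\<le>d. scale (representation (set bs) x (bs ! j)) (bs ! j))"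
    unfolding set_eq_nth_image[OF len] sum.reindex[OF inj] by (simp only: o_def)
  then have "F x = (\<Sum>j\<le>d. scale (representation (set bs) x (bs ! j)) (F (bs ! j)))"
    by (metis (no_types, lifting) F.sum F.scale sum.cong)
  then have "representation (set bs) (F x) (bs ! i) =
     (\<Sum>j\<le>d. representation (set bs) x (bs ! j) * representation (set bs) (F (bs ! j)) (bs ! i))"
    using ind span by (simp add: representation_sum representation_scale)
  then show ?thesis
    using i len by (simp add: matrix_wrt_def mult.commute)
qed

lemma tridiagonal_coords_of_basis:
  assumes bs: "ordered_basis scale bs" and len: "length bs = Suc d"
    and A: "Vector_Spaces.linear scale scale A" and B: "Vector_Spaces.linear scale scale B"
    and diag: "diagonal_mat (matrix_wrt scale bs B)"
    and tri: "irreducible_tridiagonal_mat (matrix_wrt scale bs A)"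
    and zero: "\<And>i. 0 < i \<Longrightarrow> i \<le> d \<Longrightarrow> matrix_wrt scale bs A $$ (i, i) = 0"
  shows "\<exists>f v l u t. tridiagonal_coords scale d f v A B (matrix_wrt scale bs A $$ (0, 0)) l u t"
proof -
  define M where "M = matrix_wrt scale bs A"
  define N where "N = matrix_wrt scale bs B"
  define R where "R = representation (set bs)"
  define f where "f i x = (if i \<le> d then R x (bs ! i) else 0)" for i x
  define l where "l i = (if i < d then M $$ (Suc i, i) else 0)" for i
  define u where "u i = (if i < d then M $$ (i, Suc i) else 0)" for i
  have dim: "dim_row M = Suc d" "dim_row N = Suc d" "dim_col N = Suc d"
    using len by (simp_all add: M_def N_def matrix_wrt_def)
  have ind: "independent (set bs)" and span: "span (set bs) = UNIV" and dist: "distinct bs"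
    using bs by (simp_all add: ordered_basis_def)
  have M0: "M $$ (i, j) = 0" if "i \<le> d" "j \<le> d" "i = j \<Longrightarrow> 0 < i" "i \<noteq> Suc j" "j \<noteq> Suc i" for i j
    using tri zero[of i] that dim
    by (cases "i = j") (auto simp: M_def irreducible_tridiagonal_mat_def tridiagonal_mat_def less_Suc_eq_le)
  have N0: "N $$ (i, j) = 0" if "i \<le> d" "j \<le> d" "i \<noteq> j" for i j
    using diag that dim by (simp add: N_def diagonal_mat_def)
  have nz: "M $$ (Suc i, i) \<noteq> 0" "M $$ (i, Suc i) \<noteq> 0" if "i < d" for i
    using tri that dim by (auto simp: M_def irreducible_tridiagonal_mat_def)
  have fA: "f i (A x) = (\<Sum>j\<in>S. M $$ (i, j) * f j x)"
    if "i \<le> d" "finite S" "\<And>j. j \<le> d \<Longrightarrow> j \<notin> S \<Longrightarrow> M $$ (i, j) = 0" for i x S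
  proof -
    have "f i (A x) = (\<Sum>j\<le>d. M $$ (i, j) * f j x)"
      using representation_apply[OF bs len A that(1)] that(1) by (simp add: f_def R_def M_def)
    \<comment> \<open>\<open>S\<close> may contain \<open>d + 1\<close>, where \<open>M\<close> has
      no entry but the coordinate is zero.\<close>
    also have "\<dots> = (\<Sum>j\<in>{..d} \<union> S. M $$ (i, j) * f j x)"
      by (rule sum.mono_neutral_left) (use that in \<open>auto simp: f_def\<close>)
    also have "\<dots> = (\<Sum>j\<in>S. M $$ (i, j) * f j x)"
      by (rule sum.mono_neutral_right) (use that in auto)
    finally show ?thesis .
  qed
  have fB: "f i (B x) = N $$ (i, i) * f i x" if "i \<le> d" for i x
  proof -
    have "f i (B x) = (\<Sum>j\<le>d. N $$ (i, j) * f j x)"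
      using representation_apply[OF bs len B that(1)] that(1) by (simp add: f_def R_def N_def)
    also have "\<dots> = (\<Sum>j\<in>{i}. N $$ (i, j) * f j x)"
      by (rule sum.mono_neutral_right) (use that N0 in auto)
    finally show ?thesis by simp
  qed
  have "tridiagonal_coords scale d f ((!) bs) A B (M $$ (0, 0)) l u (\<lambda>i. N $$ (i, i))"
  proof unfold_locales
    fix i j :: nat and x y :: 'b and k :: 'a
    show "f i (x + y) = f i x + f i y" "f i (scale k x) = k * f i x"
      using ind span by (simp_all add: f_def R_def representation_add representation_scale)
    show "f i (bs ! j) = (if i = j then 1 else 0)" if "j \<le> d"
      using that len dist ind
      by (auto simp: f_def R_def representation_basis nth_eq_iff_index_eq)
    show "f i x = 0" if "d < i"
      using that by (simp add: f_def)
    show "x = 0" if "\<And>i. i \<le> d \<Longrightarrow> f i x = 0"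
    proof -
      have "R x b = 0" if "b \<in> set bs" for b
        using that \<open>\<And>i. i \<le> d \<Longrightarrow> f i x = 0\<close> set_eq_nth_image[OF len] by (auto simp: f_def)
      moreover have "(\<Sum>b\<in>set bs. scale (R x b) b) = x"
        unfolding R_def by (rule sum_representation_eq) (use ind span in auto)
      ultimately show ?thesis by simp
    qed
    show "f i (B x) = N $$ (i, i) * f i x"
      using fB by (cases "i \<le> d") (simp_all add: f_def)
    have "f 0 (A x) = (\<Sum>j\<in>{0, Suc 0}. M $$ (0, j) * f j x)"
      by (rule fA) (auto intro: M0)
    then show "f 0 (A x) = M $$ (0, 0) * f 0 x + u 0 * f (Suc 0) x"
      by (cases "d = 0") (simp_all add: u_def f_def)
    show "f (Suc i) (A x) = l i * f i x + u (Suc i) * f (Suc (Suc i)) x"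
    proof (cases "Suc i \<le> d")
      case True
      have "f (Suc i) (A x) = (\<Sum>j\<in>{i, Suc (Suc i)}. M $$ (Suc i, j) * f j x)"
        by (rule fA) (use True in \<open>auto intro: M0\<close>)
      then show ?thesis
        using True by (simp add: u_def l_def f_def)
    qed (simp add: f_def l_def u_def)
  qed (use nz in \<open>auto simp: l_def u_def\<close>)
  then show ?thesis unfolding M_def by blast
qed

end

section \<open>Reversing a basis, and the two kinds of Leonard pairs\<close>

lemma matrix_wrt_rev:
  assumes "i < length bs" "j < length bs"
  shows "matrix_wrt scale (rev bs) F $$ (i, j) =
    matrix_wrt scale bs F $$ (length bs - Suc i, length bs - Suc j)"
  using assms by (simp add: matrix_wrt_def rev_nth)

lemma diagonal_mat_matrix_wrt_rev:
  assumes "diagonal_mat (matrix_wrt scale bs F)"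
  shows "diagonal_mat (matrix_wrt scale (rev bs) F)"
proof -
  let ?n = "length bs"
  have *: "matrix_wrt scale bs F $$ (i, j) = 0" if "i < ?n" "j < ?n" "i \<noteq> j" for i j
    using assms that by (simp add: diagonal_mat_def matrix_wrt_def)
  have "matrix_wrt scale (rev bs) F $$ (i, j) = 0" if "i < ?n" "j < ?n" "i \<noteq> j" for i j
    using that by (auto simp: matrix_wrt_rev intro!: *)
  then show ?thesis
    by (simp add: diagonal_mat_def) (simp add: matrix_wrt_def)
qed

lemma irreducible_tridiagonal_mat_matrix_wrt_rev:
  assumes "irreducible_tridiagonal_mat (matrix_wrt scale bs F)"
  shows "irreducible_tridiagonal_mat (matrix_wrt scale (rev bs) F)"
proof -
  let ?n = "length bs" and ?M = "matrix_wrt scale bs F" and ?M' = "matrix_wrt scale (rev bs) F"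
  have dim: "dim_row ?M = ?n" "dim_col ?M = ?n" "dim_row ?M' = ?n" "dim_col ?M' = ?n"
    by (simp_all add: matrix_wrt_def)
  have 1: "i = j \<or> i = Suc j \<or> j = Suc i" if "i < ?n" "j < ?n" "?M $$ (i, j) \<noteq> 0" for i j
    using assms that dim by (simp add: irreducible_tridiagonal_mat_def tridiagonal_mat_def)
  have 2: "?M $$ (Suc i, i) \<noteq> 0" "?M $$ (i, Suc i) \<noteq> 0" if "Suc i < ?n" for i
    using assms that dim by (simp_all add: irreducible_tridiagonal_mat_def)
  have "i = j \<or> i = Suc j \<or> j = Suc i" if "i < ?n" "j < ?n" "?M' $$ (i, j) \<noteq> 0" for i j
  proof -
    have "?n - Suc i = ?n - Suc j \<or> ?n - Suc i = Suc (?n - Suc j) \<or> ?n - Suc j = Suc (?n - Suc i)"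
      using that by (intro 1) (simp_all add: matrix_wrt_rev)
    then show ?thesis using that by arith
  qed
  moreover have "?M' $$ (Suc i, i) \<noteq> 0 \<and> ?M' $$ (i, Suc i) \<noteq> 0" if "Suc i < ?n" for i
  proof -
    have "?n - Suc i = Suc (?n - Suc (Suc i))" using that by simp
    then show ?thesis using 2[of "?n - Suc (Suc i)"] that by (simp add: matrix_wrt_rev)
  qed
  ultimately show ?thesis
    by (simp add: irreducible_tridiagonal_mat_def tridiagonal_mat_def dim)
qed

context vector_space
begin

lemma length_ordered_basis: "ordered_basis scale bs \<Longrightarrow> length bs = dim UNIV"
  using basis_card_eq_dim[of "set bs" UNIV] by (simp add: ordered_basis_def distinct_card)

lemma ordered_basis_rev: "ordered_basis scale (rev bs) \<longleftrightarrow> ordered_basis scale bs"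
  by (simp add: ordered_basis_def)

lemma coords_of_bipartite:
  assumes "dim UNIV = d + 1" and "Vector_Spaces.linear scale scale A" "Vector_Spaces.linear scale scale B"
    and bs: "ordered_basis scale bs" "diagonal_mat (matrix_wrt scale bs B)"
      "irreducible_tridiagonal_mat (matrix_wrt scale bs A)" "bipartite_mat (matrix_wrt scale bs A)"
  shows "\<exists>f v l u t. tridiagonal_coords scale d f v A B 0 l u t"
proof -
  have len: "length bs = Suc d" using length_ordered_basis[OF bs(1)] assms(1) by simp
  have zero: "matrix_wrt scale bs A $$ (i, i) = 0" if "i \<le> d" for i
    using bs(4) len that by (simp add: bipartite_mat_def) (simp add: matrix_wrt_def)
  show ?thesis
    using tridiagonal_coords_of_basis[OF bs(1) len assms(2,3) bs(2,3)] zero by simp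
qed

lemma coords_of_almost_bipartite:
  assumes "dim UNIV = d + 1" and "Vector_Spaces.linear scale scale A" "Vector_Spaces.linear scale scale B"
    and bs: "ordered_basis scale bs" "diagonal_mat (matrix_wrt scale bs B)"
      "irreducible_tridiagonal_mat (matrix_wrt scale bs A)" "almost_bipartite_mat (matrix_wrt scale bs A)"
  shows "\<exists>f v c l u t. c \<noteq> 0 \<and> tridiagonal_coords scale d f v A B c l u t"
proof -
  let ?M = "matrix_wrt scale bs A"
  have len: "length bs = Suc d" using length_ordered_basis[OF bs(1)] assms(1) by simp
  then have "dim_row ?M = Suc d" by (simp add: matrix_wrt_def)
  then have ends: "d = 0 \<Longrightarrow> ?M $$ (0, 0) \<noteq> 0" "0 < d \<Longrightarrow> ?M $$ (0, 0) = 0 \<longleftrightarrow> ?M $$ (d, d) \<noteq> 0"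
    and mid: "\<And>i. 1 \<le> i \<Longrightarrow> i < d \<Longrightarrow> ?M $$ (i, i) = 0"
    using bs(4) by (auto simp: almost_bipartite_mat_def Let_def)
  show ?thesis
  proof (cases "?M $$ (0, 0) = 0")
    case False
    have "?M $$ (i, i) = 0" if "0 < i" "i \<le> d" for i
      using that ends(2) mid[of i] False by (cases "i = d") auto
    with False tridiagonal_coords_of_basis[OF bs(1) len assms(2,3) bs(2,3)] show ?thesis by blast
  next
    case True
    \<comment> \<open>The nonzero diagonal entry is the last one; reversal moves it to index
      0.\<close>
    let ?M' = "matrix_wrt scale (rev bs) A"
    have M': "?M' $$ (i, i) = ?M $$ (d - i, d - i)" if "i \<le> d" for i
      using that len by (simp add: matrix_wrt_rev)
    have "?M' $$ (i, i) = 0" if "0 < i" "i \<le> d" for i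
      using that mid[of "d - i"] True by (cases "i = d") (auto simp: M')
    moreover have "?M' $$ (0, 0) \<noteq> 0"
      using ends True by (cases "d = 0") (simp_all add: M')
    ultimately show ?thesis
      using tridiagonal_coords_of_basis[of "rev bs" d A B] len assms(2,3) bs(1)
        diagonal_mat_matrix_wrt_rev[OF bs(2)] irreducible_tridiagonal_mat_matrix_wrt_rev[OF bs(3)]
      unfolding ordered_basis_rev length_rev by blast
  qed
qed

end

theorem theorem8p14:
  fixes scale :: "'k::{alg_closed_field, field_char_0} \<Rightarrow> 'v::ab_group_add \<Rightarrow> 'v"
    and d :: nat
    and A A' :: "'v \<Rightarrow> 'v"
  assumes "vector_space scale"
    and "vector_space.dim scale (UNIV :: 'v set) = d + 1"
    and "totally_bipartite scale A A' \<or>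
         totally_almost_bipartite scale A A'"
  shows "\<exists>\<beta> \<rho> \<rho>' :: 'k. \<rho> \<noteq> 0 \<and> \<rho>' \<noteq> 0 \<and>
    (\<forall>x. A (A (A' x)) - scale \<beta> (A (A' (A x))) + A' (A (A x)) = scale \<rho> (A' x)) \<and>
    (\<forall>x. A' (A' (A x)) - scale \<beta> (A' (A (A' x))) + A (A' (A' x)) = scale \<rho>' (A x))"
proof -
  interpret vector_space scale by (rule assms(1))
  have lin: "Vector_Spaces.linear scale scale A" "Vector_Spaces.linear scale scale A'"
    using assms(3) by (auto simp: totally_bipartite_def totally_almost_bipartite_def leonard_pair_def)
  \<comment> \<open>Both matrices are of the same kind, so \<open>c\<close> and \<open>c'\<close>
    are both zero or both nonzero.\<close>
  obtain f v c l u t g w c' l' u' t' where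
    "tridiagonal_coords scale d f v A A' c l u t" "tridiagonal_coords scale d g w A' A c' l' u' t'"
    and c: "c = 0 \<longleftrightarrow> c' = 0"
    using assms(3)
  proof
    assume "totally_bipartite scale A A'"
    then show thesis
      using that coords_of_bipartite[OF assms(2) lin] coords_of_bipartite[OF assms(2) lin(2,1)]
      unfolding totally_bipartite_def by metis
  next
    assume "totally_almost_bipartite scale A A'"
    then show thesis
      using that coords_of_almost_bipartite[OF assms(2) lin]
        coords_of_almost_bipartite[OF assms(2) lin(2,1)]
      unfolding totally_almost_bipartite_def by metis
  qed
  then interpret leonard_coords scale d f v A A' c l u t g w c' l' u' t'
    by (simp add: leonard_coords_def)
  show ?thesis
    using cubic_relations[OF c] unfolding cubic_relations_def .
qed

end
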